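(* Let $\omega$ be an arbitrary nonvanishing real parameter, let $\alpha_1,\alpha_2,\beta_1,\beta_2$ be arbitrary complex parameters, and let $\mathbf i=\sqrt{-1}$. Consider the system of $2$ first-order ODEs for the complex dependent variables $\tilde x_1(t),\tilde x_2(t)$ of the real time variable $t$: $$\dot{\tilde x}_1(t)=\mathbf i\omega\tilde x_1(t)+\frac{\tilde x_1(t)+\alpha_1\tilde x_2(t)}{\beta_1[\tilde x_1(t)]^2+(\alpha_1\beta_1+\alpha_2\beta_2)\tilde x_1(t)\tilde x_2(t)+\beta_2[\tilde x_2(t)]^2},$$ $$\dot{\tilde x}_2(t)=\mathbf i\omega\tilde x_2(t)-\frac{\tilde x_2(t)+\alpha_2\tilde x_1(t)}{\beta_1[\tilde x_1(t)]^2+(\alpha_1\beta_1+\alpha_2\beta_2)\tilde x_1(t)\tilde x_2(t)+\beta_2[\tilde x_2(t)]^2}.$$ This system is isochronous: all its nonsingular solutions are completely periodic in the real time variable $t$, with a period which is $4$ times (or, for a subset of solutions, only $2$ times) the basic period $T=\pi/|\omega|$. (In terms of real variables and real parameters, this is a system of $4$ nonlinear ODEs in $4$ real dependent variables featuring $9$ arbitrary real parameters.)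
   Context: The superimposed dot denotes differentiation with respect to $t$; all parameters are $t$-independent. A solution is nonsingular if it exists (satisfying the ODEs, with nonvanishing denominators) for all real $t$. A solution is completely periodic with period $P$ if both dependent variables satisfy $\tilde x_n(t+P)=\tilde x_n(t)$ for all real $t$, $n=1,2$; here $P$ is a period, not asserted to be the minimal one. *)

theory Defs
  imports "HOL-Analysis.Analysis"
begin

definition denom :: "complex \<Rightarrow> complex \<Rightarrow> complex \<Rightarrow> complex \<Rightarrow> complex \<Rightarrow> complex \<Rightarrow> complex" where
  "denom \<alpha>1 \<alpha>2 \<beta>1 \<beta>2 z1 z2 =
     \<beta>1 * z1\<^sup>2 + (\<alpha>1 * \<beta>1 + \<alpha>2 * \<beta>2) * z1 * z2 + \<beta>2 * z2\<^sup>2"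

text \<open>As a polynomial in \<open>z1\<close> and \<open>z2\<close>, the denominator is zero exactly when \<open>\<beta>1 = \<beta>2 = 0\<close>;
  in that case there are no nonsingular solutions at all.\<close>

text \<open>The nonvanishing of the denominator has to be required explicitly, because division
  by zero yields zero in HOL.\<close>

definition nonsingular_solution ::
  "real \<Rightarrow> complex \<Rightarrow> complex \<Rightarrow> complex \<Rightarrow> complex \<Rightarrow>
   (real \<Rightarrow> complex) \<Rightarrow> (real \<Rightarrow> complex) \<Rightarrow> bool" where
  "nonsingular_solution \<omega> \<alpha>1 \<alpha>2 \<beta>1 \<beta>2 x1 x2 \<longleftrightarrow>
     (\<forall>t. denom \<alpha>1 \<alpha>2 \<beta>1 \<beta>2 (x1 t) (x2 t) \<noteq> 0 \<and>
          (x1 has_vector_derivative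
             (\<i> * of_real \<omega> * x1 t
                + (x1 t + \<alpha>1 * x2 t) / denom \<alpha>1 \<alpha>2 \<beta>1 \<beta>2 (x1 t) (x2 t))) (at t) \<and>
          (x2 has_vector_derivative
             (\<i> * of_real \<omega> * x2 t
                - (x2 t + \<alpha>2 * x1 t) / denom \<alpha>1 \<alpha>2 \<beta>1 \<beta>2 (x1 t) (x2 t))) (at t))"

text \<open>\<open>P\<close> is a period, not necessarily the minimal one.\<close>

definition completely_periodic ::
  "real \<Rightarrow> (real \<Rightarrow> complex) \<Rightarrow> (real \<Rightarrow> complex) \<Rightarrow> bool" where
  "completely_periodic P x1 x2 \<longleftrightarrow> (\<forall>t. x1 (t + P) = x1 t \<and> x2 (t + P) = x2 t)"

definition isochronous_with_period ::
  "real \<Rightarrow> complex \<Rightarrow> complex \<Rightarrow> complex \<Rightarrow> complex \<Rightarrow> real \<Rightarrow> bool" where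
  "isochronous_with_period \<omega> \<alpha>1 \<alpha>2 \<beta>1 \<beta>2 P \<longleftrightarrow>
     (\<forall>x1 x2. nonsingular_solution \<omega> \<alpha>1 \<alpha>2 \<beta>1 \<beta>2 x1 x2 \<longrightarrow> completely_periodic P x1 x2)"

definition basic_period :: "real \<Rightarrow> real" where
  "basic_period \<omega> = pi / \<bar>\<omega>\<bar>"

end

theory Submission
  imports Defs
begin

text \<open>The quadratic forms \<open>H = 2 x\<^sub>1 x\<^sub>2 + \<alpha>\<^sub>1 x\<^sub>2\<^sup>2 + \<alpha>\<^sub>2 x\<^sub>1\<^sup>2\<close> and
  \<open>Q = \<beta>\<^sub>1 x\<^sub>1\<^sup>2 - \<beta>\<^sub>2 x\<^sub>2\<^sup>2\<close> satisfy \<open>H' = 2\<i>\<omega>H\<close> and \<open>Q' = 2\<i>\<omega>Q + 2\<close> along solutions, so both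
  are \<open>T\<close>-periodic, and their Jacobian is a multiple of the denominator \<open>D\<close>.
  By polarization, two distinct points with equal \<open>H\<close> and \<open>Q\<close> satisfy \<open>D (p + q) = 0\<close>. Hence
  for two nonsingular solutions with equal \<open>H\<close> and \<open>Q\<close>, coincidence is both a closed and an open
  condition on \<open>t\<close>. By the parallelogram law for \<open>D\<close>, among \<open>x t\<close>, \<open>x (t + T)\<close>, \<open>x (t + 2T)\<close> two
  agree up to sign; so \<open>x (t + kT) = \<plusminus> x t\<close> for all \<open>t\<close> with \<open>k = 1\<close> or \<open>k = 2\<close>.\<close>

section \<open>Quadratic forms and polarization\<close>

definition hform :: "complex \<Rightarrow> complex \<Rightarrow> complex \<Rightarrow> complex \<Rightarrow> complex" where
  "hform \<alpha>1 \<alpha>2 z1 z2 = 2 * z1 * z2 + \<alpha>1 * z2\<^sup>2 + \<alpha>2 * z1\<^sup>2"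

definition qform :: "complex \<Rightarrow> complex \<Rightarrow> complex \<Rightarrow> complex \<Rightarrow> complex" where
  "qform \<beta>1 \<beta>2 z1 z2 = \<beta>1 * z1\<^sup>2 - \<beta>2 * z2\<^sup>2"

lemma denom_eq:
  "denom \<alpha>1 \<alpha>2 \<beta>1 \<beta>2 z1 z2 = \<beta>1 * z1 * (z1 + \<alpha>1 * z2) + \<beta>2 * z2 * (z2 + \<alpha>2 * z1)"
  by (simp add: denom_def algebra_simps power2_eq_square)

lemma denom_double: "denom \<alpha>1 \<alpha>2 \<beta>1 \<beta>2 (2 * z1) (2 * z2) = 4 * denom \<alpha>1 \<alpha>2 \<beta>1 \<beta>2 z1 z2"
  by (simp add: denom_def algebra_simps power2_eq_square)

lemma denom_uminus: "denom \<alpha>1 \<alpha>2 \<beta>1 \<beta>2 (- z1) (- z2) = denom \<alpha>1 \<alpha>2 \<beta>1 \<beta>2 z1 z2"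
  by (simp add: denom_def)

lemma hform_uminus: "hform \<alpha>1 \<alpha>2 (- z1) (- z2) = hform \<alpha>1 \<alpha>2 z1 z2"
  by (simp add: hform_def)

lemma qform_uminus: "qform \<beta>1 \<beta>2 (- z1) (- z2) = qform \<beta>1 \<beta>2 z1 z2"
  by (simp add: qform_def)

lemma denom_parallelogram:
  "denom \<alpha>1 \<alpha>2 \<beta>1 \<beta>2 (p1 + q1) (p2 + q2) + denom \<alpha>1 \<alpha>2 \<beta>1 \<beta>2 (p1 - q1) (p2 - q2) =
     2 * (denom \<alpha>1 \<alpha>2 \<beta>1 \<beta>2 p1 p2 + denom \<alpha>1 \<alpha>2 \<beta>1 \<beta>2 q1 q2)"
  by (simp add: denom_def algebra_simps power2_eq_square)

text \<open>By polarization the two hypotheses form a homogeneous linear system for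
  \<open>p - q\<close>, with rows \<open>(?v, ?u)\<close> and
  \<open>(\<beta>1 * (p1 + q1), - \<beta>2 * (p2 + q2))\<close>. Its determinant is minus the
  denominator at \<open>p + q\<close>, so Cramer's rule forces \<open>p - q = 0\<close>.\<close>

lemma eq_if_forms_eq:
  assumes H: "hform \<alpha>1 \<alpha>2 p1 p2 = hform \<alpha>1 \<alpha>2 q1 q2"
    and Q: "qform \<beta>1 \<beta>2 p1 p2 = qform \<beta>1 \<beta>2 q1 q2"
    and D: "denom \<alpha>1 \<alpha>2 \<beta>1 \<beta>2 (p1 + q1) (p2 + q2) \<noteq> 0"
  shows "p1 = q1 \<and> p2 = q2"
proof -
  let ?u = "(p1 + q1) + \<alpha>1 * (p2 + q2)" and ?v = "(p2 + q2) + \<alpha>2 * (p1 + q1)"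
  have h: "(p1 - q1) * ?v + (p2 - q2) * ?u = 0"
    using H by (simp add: hform_def algebra_simps power2_eq_square)
  have q: "(p1 - q1) * (\<beta>1 * (p1 + q1)) = (p2 - q2) * (\<beta>2 * (p2 + q2))"
    using Q by (simp add: qform_def algebra_simps power2_eq_square)
  have "(p1 - q1) * denom \<alpha>1 \<alpha>2 \<beta>1 \<beta>2 (p1 + q1) (p2 + q2)
      = ((p1 - q1) * (\<beta>1 * (p1 + q1))) * ?u + \<beta>2 * (p2 + q2) * ((p1 - q1) * ?v)"
    unfolding denom_eq by (simp only: algebra_simps)
  also have "\<dots> = \<beta>2 * (p2 + q2) * ((p1 - q1) * ?v + (p2 - q2) * ?u)"
    unfolding q by (simp only: algebra_simps)
  finally have "p1 = q1" using h D by simp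
  have "(p2 - q2) * denom \<alpha>1 \<alpha>2 \<beta>1 \<beta>2 (p1 + q1) (p2 + q2)
      = \<beta>1 * (p1 + q1) * ((p2 - q2) * ?u) + ((p2 - q2) * (\<beta>2 * (p2 + q2))) * ?v"
    unfolding denom_eq by (simp only: algebra_simps)
  also have "\<dots> = \<beta>1 * (p1 + q1) * ((p1 - q1) * ?v + (p2 - q2) * ?u)"
    unfolding q[symmetric] by (simp only: algebra_simps)
  finally have "p2 = q2" using h D by simp
  with \<open>p1 = q1\<close> show ?thesis by simp
qed

text \<open>Both forms are even, so the previous lemma applies to \<open>q\<close> and to
  \<open>- q\<close>: the denominator vanishes at \<open>p + q\<close> and at \<open>p - q\<close>,
  and the parallelogram law adds the two.\<close>

lemma denom_sum_zero_if_forms_eq: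
  assumes H: "hform \<alpha>1 \<alpha>2 p1 p2 = hform \<alpha>1 \<alpha>2 q1 q2"
    and Q: "qform \<beta>1 \<beta>2 p1 p2 = qform \<beta>1 \<beta>2 q1 q2"
    and ne: "\<not> (p1 = q1 \<and> p2 = q2)" "\<not> (p1 = - q1 \<and> p2 = - q2)"
  shows "denom \<alpha>1 \<alpha>2 \<beta>1 \<beta>2 p1 p2 + denom \<alpha>1 \<alpha>2 \<beta>1 \<beta>2 q1 q2 = 0"
proof -
  have "denom \<alpha>1 \<alpha>2 \<beta>1 \<beta>2 (p1 + q1) (p2 + q2) = 0"
    using eq_if_forms_eq[OF H Q] ne(1) by blast
  moreover have "denom \<alpha>1 \<alpha>2 \<beta>1 \<beta>2 (p1 - q1) (p2 - q2) = 0"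
    using eq_if_forms_eq[of \<alpha>1 \<alpha>2 p1 p2 "- q1" "- q2" \<beta>1 \<beta>2] ne(2) H Q
    by (auto simp: hform_uminus qform_uminus)
  ultimately have "2 * (denom \<alpha>1 \<alpha>2 \<beta>1 \<beta>2 p1 p2 + denom \<alpha>1 \<alpha>2 \<beta>1 \<beta>2 q1 q2) = 0"
    unfolding denom_parallelogram[symmetric] by simp
  then show ?thesis
    unfolding mult_eq_0_iff by simp
qed

lemma eq_everywhere_if_forms_eq:
  fixes x1 x2 y1 y2 :: "real \<Rightarrow> complex"
  assumes H: "\<And>t. hform \<alpha>1 \<alpha>2 (x1 t) (x2 t) = hform \<alpha>1 \<alpha>2 (y1 t) (y2 t)"
    and Q: "\<And>t. qform \<beta>1 \<beta>2 (x1 t) (x2 t) = qform \<beta>1 \<beta>2 (y1 t) (y2 t)"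
    and D: "\<And>t. denom \<alpha>1 \<alpha>2 \<beta>1 \<beta>2 (x1 t) (x2 t) \<noteq> 0"
    and cont [continuous_intros]: "continuous_on UNIV x1" "continuous_on UNIV x2"
      "continuous_on UNIV y1" "continuous_on UNIV y2"
    and init: "x1 s = y1 s" "x2 s = y2 s"
  shows "x1 t = y1 t \<and> x2 t = y2 t"
proof -
  let ?S = "{t. x1 t = y1 t \<and> x2 t = y2 t}"
  \<comment> \<open>At a coincidence the denominator of the sum is \<open>4\<close> times the
    nonzero denominator along \<open>x\<close>; elsewhere polarization makes it zero. So an equation
    and an inequation describe the same set, and connectedness of the line finishes.\<close>
  have "x1 t = y1 t \<and> x2 t = y2 t \<longleftrightarrow> denom \<alpha>1 \<alpha>2 \<beta>1 \<beta>2 (x1 t + y1 t) (x2 t + y2 t) \<noteq> 0" for t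
    using eq_if_forms_eq[OF H Q, of t] D[of t] by (auto simp: denom_double simp flip: mult_2)
  then have S: "?S = {t. denom \<alpha>1 \<alpha>2 \<beta>1 \<beta>2 (x1 t + y1 t) (x2 t + y2 t) \<noteq> 0}"
    by simp
  have "closed ?S"
    by (intro closed_Collect_conj closed_Collect_eq continuous_intros)
  moreover have "open ?S"
    unfolding S denom_def by (intro open_Collect_neq continuous_intros)
  ultimately have "?S = UNIV"
    using init clopen[of ?S] by blast
  then show ?thesis by blast
qed

section \<open>Evolution of the forms along solutions\<close>

lemma nonsingular_solution_continuous:
  assumes "nonsingular_solution \<omega> \<alpha>1 \<alpha>2 \<beta>1 \<beta>2 x1 x2"
  shows "continuous_on UNIV x1" "continuous_on UNIV x2"
  using assms unfolding nonsingular_solution_def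
  by (auto intro!: continuous_at_imp_continuous_on intro: has_vector_derivative_continuous)

lemma exp_linear_has_vector_derivative:
  fixes c :: complex
  shows "((\<lambda>t. exp (c * of_real t)) has_vector_derivative c * exp (c * of_real t)) (at t)"
proof -
  have "((\<lambda>z. exp (c * z)) has_field_derivative c * exp (c * of_real t)) (at (of_real t))"
    by (auto intro!: derivative_eq_intros)
  then show ?thesis
    by (rule has_vector_derivative_real_field)
qed

lemma solution_of_linear_ode:
  fixes f :: "real \<Rightarrow> complex"
  assumes "\<And>t. (f has_vector_derivative c * f t) (at t)"
  shows "\<exists>k. \<forall>t. f t = k * exp (c * of_real t)"
proof -
  let ?g = "\<lambda>t. f t * exp (- c * of_real t)"
  have "(?g has_vector_derivative f t * (- c * exp (- c * of_real t)) + c * f t * exp (- c * of_real t)) (at t)"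
    for t
    by (rule has_vector_derivative_mult[OF assms exp_linear_has_vector_derivative])
  then have "(?g has_vector_derivative 0) (at t)" for t
    by (simp add: algebra_simps)
  then obtain k where "\<And>t. t \<in> UNIV \<Longrightarrow> ?g t = k"
    using has_vector_derivative_zero_constant[OF convex_UNIV, of ?g] by blast
  then have k: "f t * exp (- c * of_real t) = k" for t
    by blast
  have "f t = k * exp (c * of_real t)" for t
    using k[of t] by (auto simp: exp_minus)
  then show ?thesis by blast
qed

text \<open>With \<open>u = x1 + \<alpha>1 * x2\<close> and \<open>v = x2 + \<alpha>2 * x1\<close>,
  the gradient of H is \<open>(2 * v, 2 * u)\<close>, orthogonal to the nonlinear term
  \<open>(u, - v) / D\<close>. The same term contributes
  \<open>2 * (\<beta>1 * x1 * u + \<beta>2 * x2 * v) / D = 2\<close> to the derivative of Q.\<close>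

lemma nonsingular_solution_forms:
  assumes sol: "nonsingular_solution \<omega> \<alpha>1 \<alpha>2 \<beta>1 \<beta>2 x1 x2" and \<omega>: "\<omega> \<noteq> 0"
  shows "\<exists>h q. \<forall>t. hform \<alpha>1 \<alpha>2 (x1 t) (x2 t) = h * exp (2 * \<i> * \<omega> * of_real t) \<and>
    qform \<beta>1 \<beta>2 (x1 t) (x2 t) = q * exp (2 * \<i> * \<omega> * of_real t) + \<i> / \<omega>"
proof -
  let ?D = "\<lambda>t. denom \<alpha>1 \<alpha>2 \<beta>1 \<beta>2 (x1 t) (x2 t)"
  have D: "?D t \<noteq> 0" for t
    using sol unfolding nonsingular_solution_def by blast
  have d1: "(x1 has_vector_derivative (\<i> * \<omega> * x1 t + (x1 t + \<alpha>1 * x2 t) / ?D t)) (at t)" for t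
    using sol unfolding nonsingular_solution_def by blast
  have d2: "(x2 has_vector_derivative (\<i> * \<omega> * x2 t - (x2 t + \<alpha>2 * x1 t) / ?D t)) (at t)" for t
    using sol unfolding nonsingular_solution_def by blast
  note dmul = has_vector_derivative_mult has_vector_derivative_mult_right
    has_vector_derivative_add has_vector_derivative_diff
  have "((\<lambda>t. hform \<alpha>1 \<alpha>2 (x1 t) (x2 t)) has_vector_derivative
      2 * \<i> * \<omega> * hform \<alpha>1 \<alpha>2 (x1 t) (x2 t)) (at t)" for t
    unfolding hform_def power2_eq_square mult.assoc
    by (rule has_vector_derivative_eq_rhs, (rule dmul d1 d2)+)
      (use D[of t] in \<open>simp add: field_simps\<close>)
  then obtain h where h: "\<forall>t. hform \<alpha>1 \<alpha>2 (x1 t) (x2 t) = h * exp (2 * \<i> * \<omega> * of_real t)"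
    using solution_of_linear_ode by blast
  \<comment> \<open>The constant \<open>\<i> / \<omega>\<close> is the fixed point of
    \<open>Q' = 2 * \<i> * \<omega> * Q + 2\<close>; subtracting it makes the equation
    homogeneous.\<close>
  have "((\<lambda>t. qform \<beta>1 \<beta>2 (x1 t) (x2 t) - \<i> / \<omega>) has_vector_derivative
      2 * \<i> * \<omega> * (qform \<beta>1 \<beta>2 (x1 t) (x2 t) - \<i> / \<omega>)) (at t)" for t
  proof -
    let ?d1 = "\<i> * \<omega> * x1 t + (x1 t + \<alpha>1 * x2 t) / ?D t"
    let ?d2 = "\<i> * \<omega> * x2 t - (x2 t + \<alpha>2 * x1 t) / ?D t"
    have "((\<lambda>t. qform \<beta>1 \<beta>2 (x1 t) (x2 t) - \<i> / \<omega>) has_vector_derivative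
        \<beta>1 * (x1 t * ?d1 + ?d1 * x1 t) - \<beta>2 * (x2 t * ?d2 + ?d2 * x2 t) - 0) (at t)"
      unfolding qform_def power2_eq_square
      by (rule dmul d1 d2 has_vector_derivative_const)+
    moreover have "\<beta>1 * (x1 t * ?d1 + ?d1 * x1 t) - \<beta>2 * (x2 t * ?d2 + ?d2 * x2 t) - 0
        = 2 * \<i> * \<omega> * qform \<beta>1 \<beta>2 (x1 t) (x2 t) + 2 * (?D t / ?D t)"
    proof -
      have "\<beta>1 * (a * (\<i> * \<omega> * a + u / d) + (\<i> * \<omega> * a + u / d) * a)
            - \<beta>2 * (b * (\<i> * \<omega> * b - v / d) + (\<i> * \<omega> * b - v / d) * b) - 0
          = 2 * \<i> * \<omega> * (\<beta>1 * a\<^sup>2 - \<beta>2 * b\<^sup>2) + 2 * ((\<beta>1 * a * u + \<beta>2 * b * v) / d)"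
        for a b u v d
        by (simp add: add_divide_distrib algebra_simps power2_eq_square)
      then show ?thesis
        \<comment> \<open>Only the numerator of \<open>?D t / ?D t\<close> is expanded; every
          denominator stays atomic, as \<open>d\<close> in the generic identity.\<close>
        unfolding qform_def by (subst (5) denom_eq)
    qed
    moreover have "\<dots> = 2 * \<i> * \<omega> * (qform \<beta>1 \<beta>2 (x1 t) (x2 t) - \<i> / \<omega>)"
      using D[of t] \<omega> by (simp add: algebra_simps)
    ultimately show ?thesis by simp
  qed
  then obtain q where
    q: "\<forall>t. qform \<beta>1 \<beta>2 (x1 t) (x2 t) - \<i> / \<omega> = q * exp (2 * \<i> * \<omega> * of_real t)"
    using solution_of_linear_ode[of "\<lambda>t. qform \<beta>1 \<beta>2 (x1 t) (x2 t) - \<i> / \<omega>"] by blast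
  show ?thesis
    using h q by (metis diff_eq_eq)
qed

section \<open>Periodicity\<close>

lemma exp_basic_period:
  assumes "\<omega> \<noteq> 0"
  shows "exp (2 * \<i> * \<omega> * of_real (t + basic_period \<omega>)) = exp (2 * \<i> * \<omega> * of_real t)"
proof -
  have "2 * \<i> * \<omega> * of_real (t + basic_period \<omega>) =
      2 * \<i> * \<omega> * of_real t + of_real (2 * of_int (if \<omega> > 0 then 1 else -1) * pi) * \<i>"
    using assms by (auto simp: basic_period_def algebra_simps)
  then show ?thesis
    by (simp add: exp_add exp_eq_1 exp_minus flip: exp_of_real)
qed

text \<open>Used for the explicit solutions when \<open>\<alpha>1 * \<alpha>2 = 1\<close>; halving
  the time reduces it to the previous lemma.\<close>

lemma exp_twice_basic_period:
  assumes "\<omega> \<noteq> 0"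
  shows "exp (\<i> * \<omega> * of_real (t + 2 * basic_period \<omega>)) = exp (\<i> * \<omega> * of_real t)"
proof -
  have "exp (\<i> * \<omega> * of_real (t + 2 * basic_period \<omega>))
      = exp (2 * \<i> * \<omega> * of_real (t / 2 + basic_period \<omega>))"
    by (simp add: algebra_simps)
  also have "\<dots> = exp (2 * \<i> * \<omega> * of_real (t / 2))"
    by (rule exp_basic_period[OF assms])
  also have "\<dots> = exp (\<i> * \<omega> * of_real t)"
    by (simp add: mult.assoc)
  finally show ?thesis .
qed

lemma nonsingular_solution_period:
  assumes sol: "nonsingular_solution \<omega> \<alpha>1 \<alpha>2 \<beta>1 \<beta>2 x1 x2" and \<omega>: "\<omega> \<noteq> 0"
  shows "completely_periodic (4 * basic_period \<omega>) x1 x2"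
proof -
  define T where "T = basic_period \<omega>"
  let ?H = "\<lambda>t. hform \<alpha>1 \<alpha>2 (x1 t) (x2 t)" and ?Q = "\<lambda>t. qform \<beta>1 \<beta>2 (x1 t) (x2 t)"
    and ?D = "\<lambda>t. denom \<alpha>1 \<alpha>2 \<beta>1 \<beta>2 (x1 t) (x2 t)"
  have D: "?D t \<noteq> 0" for t
    using sol unfolding nonsingular_solution_def by blast
  obtain h q where hq: "?H t = h * exp (2 * \<i> * \<omega> * of_real t)"
      "?Q t = q * exp (2 * \<i> * \<omega> * of_real t) + \<i> / \<omega>" for t
    using nonsingular_solution_forms[OF sol \<omega>] by blast
  have step: "?H (t + T) = ?H t" "?Q (t + T) = ?Q t" for t
    unfolding hq T_def exp_basic_period[OF \<omega>] by simp_all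
  have step2: "?H (t + 2 * T) = ?H t" "?Q (t + 2 * T) = ?Q t" for t
    using step[of t] step[of "t + T"] by (simp_all add: algebra_simps)
  have cont: "continuous_on UNIV x1" "continuous_on UNIV x2"
    using nonsingular_solution_continuous[OF sol] .
  have shift: "continuous_on UNIV (\<lambda>t. x1 (t + P))" "continuous_on UNIV (\<lambda>t. x2 (t + P))" for P
    by (rule continuous_on_compose2[OF cont(1)] continuous_on_compose2[OF cont(2)];
        auto intro!: continuous_intros)+
  \<comment> \<open>Agreement up to sign with the shift by \<open>P\<close> at one instant
    \<open>s\<close> propagates to all times with the same sign; applying the shift twice removes
    the sign.\<close>
  have two: "completely_periodic (2 * P) x1 x2"
    if P: "\<And>t. ?H (t + P) = ?H t" "\<And>t. ?Q (t + P) = ?Q t"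
      and s: "x1 s = x1 (s + P) \<and> x2 s = x2 (s + P) \<or> x1 s = - x1 (s + P) \<and> x2 s = - x2 (s + P)"
    for P s
    using s
  proof
    assume init: "x1 s = x1 (s + P) \<and> x2 s = x2 (s + P)"
    have *: "x1 t = x1 (t + P) \<and> x2 t = x2 (t + P)" for t
      by (rule eq_everywhere_if_forms_eq[OF P(1)[symmetric] P(2)[symmetric] D cont shift
            conjunct1[OF init] conjunct2[OF init]])
    have eq: "x1 (t + P) = x1 t" "x2 (t + P) = x2 t" for t
      using *[of t] by simp_all
    show ?thesis
      unfolding completely_periodic_def mult_2 add.assoc[symmetric] eq by blast
  next
    assume init: "x1 s = - x1 (s + P) \<and> x2 s = - x2 (s + P)"
    have *: "x1 t = - x1 (t + P) \<and> x2 t = - x2 (t + P)" for t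
      by (rule eq_everywhere_if_forms_eq[of \<alpha>1 \<alpha>2 _ _ "\<lambda>t. - x1 (t + P)" "\<lambda>t. - x2 (t + P)" \<beta>1 \<beta>2,
            OF _ _ D cont continuous_on_minus[OF shift(1)] continuous_on_minus[OF shift(2)]
            conjunct1[OF init] conjunct2[OF init]])
        (simp_all only: hform_uminus qform_uminus P)
    have eq: "x1 (t + P) = - x1 t" "x2 (t + P) = - x2 t" for t
      using *[of t] by simp_all
    show ?thesis
      unfolding completely_periodic_def mult_2 add.assoc[symmetric] eq minus_minus by blast
  qed
  let ?pm = "\<lambda>s P. x1 s = x1 (s + P) \<and> x2 s = x2 (s + P) \<or> x1 s = - x1 (s + P) \<and> x2 s = - x2 (s + P)"
  \<comment> \<open>Otherwise the denominators at \<open>0\<close>, \<open>T\<close> and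
    \<open>2 * T\<close> have pairwise sums zero, so the one at \<open>T\<close> vanishes.\<close>
  have "?pm 0 T \<or> ?pm T T \<or> ?pm 0 (2 * T)"
  proof (rule ccontr)
    assume "\<not> ?thesis"
    then have "?D 0 + ?D (0 + T) = 0" "?D T + ?D (T + T) = 0" "?D 0 + ?D (0 + 2 * T) = 0"
      using denom_sum_zero_if_forms_eq[OF step[symmetric], of 0]
        denom_sum_zero_if_forms_eq[OF step[symmetric], of T]
        denom_sum_zero_if_forms_eq[OF step2[symmetric], of 0]
      by blast+
    moreover have "2 * ?D T = (?D 0 + ?D (0 + T)) + (?D T + ?D (T + T)) - (?D 0 + ?D (0 + 2 * T))"
      by simp
    ultimately have "2 * ?D T = 0"
      by (simp only: add_0 diff_0_right)
    then show False using D[of T] by simp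
  qed
  then consider s where "?pm s T" | "?pm 0 (2 * T)" by blast
  then show ?thesis
  proof cases
    case 1
    have "completely_periodic (2 * T) x1 x2"
      by (rule two[of T s, OF step 1])
    then have eq: "x1 (t + 2 * T) = x1 t \<and> x2 (t + 2 * T) = x2 t" for t
      by (simp add: completely_periodic_def)
    have "t + 4 * T = t + 2 * T + 2 * T" for t
      by simp
    then show ?thesis
      unfolding completely_periodic_def T_def[symmetric] by (simp only: eq simp_thms)
  next
    case 2
    have "completely_periodic (2 * (2 * T)) x1 x2"
      by (rule two[of "2 * T" 0, OF step2 2])
    then show ?thesis
      by (simp add: T_def)
  qed
qed

section \<open>Solutions of period twice the basic one\<close>

text \<open>The equilibrium is an eigenvector, with eigenvalue \<open>- \<kappa> \<noteq> 0\<close>, of the linear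
  part of the Hamiltonian field of \<open>H / 2\<close>, scaled to \<open>Q = \<i> / \<omega>\<close>.\<close>

lemma equilibrium_exists:
  assumes \<omega>: "\<omega> \<noteq> 0" and \<alpha>: "\<alpha>1 * \<alpha>2 \<noteq> 1" and \<beta>: "\<beta>1 \<noteq> 0 \<or> \<beta>2 \<noteq> 0"
  shows "\<exists>c1 c2. nonsingular_solution \<omega> \<alpha>1 \<alpha>2 \<beta>1 \<beta>2 (\<lambda>t. c1) (\<lambda>t. c2)"
proof -
  define k where "k = csqrt (1 - \<alpha>1 * \<alpha>2)"
  have k2: "k * k = 1 - \<alpha>1 * \<alpha>2"
    by (simp add: k_def flip: power2_eq_square)
  then have k0: "k \<noteq> 0" using \<alpha> by auto
  have "\<exists>\<kappa> v1 v2. \<kappa> \<noteq> 0 \<and> v1 + \<alpha>1 * v2 = - \<kappa> * v1 \<and> v2 + \<alpha>2 * v1 = \<kappa> * v2 \<and>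
    qform \<beta>1 \<beta>2 v1 v2 \<noteq> 0"
  proof (cases "\<alpha>1 = 0")
    case True
    show ?thesis
    proof (cases "\<beta>2 = 0")
      case False
      \<comment> \<open>The choice of zeros and ones that works is \<open>\<kappa> = 1\<close>,
        \<open>v = (0, 1)\<close>, where Q is \<open>- \<beta>2\<close>.\<close>
      then show ?thesis
        using True by (intro exI[of _ 1] exI[of _ 0]) (auto simp: qform_def)
    next
      case b: True
      have "(1::complex) + \<alpha>1 * (- \<alpha>2 / 2) = - (-1) * 1 \<and>
        - \<alpha>2 / 2 + \<alpha>2 * 1 = (-1) * (- \<alpha>2 / 2) \<and> qform \<beta>1 \<beta>2 1 (- \<alpha>2 / 2) \<noteq> 0"
        using True b \<beta> by (auto simp: qform_def)
      then show ?thesis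
        by (intro exI[of _ "-1"] exI[of _ 1] exI[of _ "- \<alpha>2 / 2"]) auto
    qed
  next
    case False
    have eig: "\<alpha>1 + \<alpha>1 * (- (1 + \<kappa>)) = - \<kappa> * \<alpha>1 \<and> - (1 + \<kappa>) + \<alpha>2 * \<alpha>1 = \<kappa> * (- (1 + \<kappa>))"
      if "\<kappa> * \<kappa> = 1 - \<alpha>1 * \<alpha>2" for \<kappa>
      using that by (simp add: algebra_simps)
    \<comment> \<open>If Q vanished on the eigenvectors for both \<open>k\<close> and
      \<open>- k\<close>, their difference would give \<open>\<beta>2 = 0\<close>, and then
      \<open>\<beta>1 = 0\<close>.\<close>
    have "qform \<beta>1 \<beta>2 \<alpha>1 (- (1 + k)) \<noteq> 0 \<or> qform \<beta>1 \<beta>2 \<alpha>1 (- (1 + - k)) \<noteq> 0"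
    proof (rule ccontr)
      assume "\<not> ?thesis"
      then have q: "qform \<beta>1 \<beta>2 \<alpha>1 (- (1 + k)) = 0" "qform \<beta>1 \<beta>2 \<alpha>1 (- (1 + - k)) = 0"
        by simp_all
      have "4 * \<beta>2 * k = qform \<beta>1 \<beta>2 \<alpha>1 (- (1 + - k)) - qform \<beta>1 \<beta>2 \<alpha>1 (- (1 + k))"
        by (simp add: qform_def power2_eq_square algebra_simps)
      then have "\<beta>2 = 0" using q k0 by simp
      then show False using q \<beta> False by (simp add: qform_def)
    qed
    then show ?thesis
      using eig[of k] eig[of "- k"] k2 k0
      by (metis minus_mult_minus neg_equal_0_iff_equal)
  qed
  then obtain \<kappa> v1 v2 where \<kappa>: "\<kappa> \<noteq> 0" and u: "v1 + \<alpha>1 * v2 = - \<kappa> * v1"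
    and v: "v2 + \<alpha>2 * v1 = \<kappa> * v2" and q: "qform \<beta>1 \<beta>2 v1 v2 \<noteq> 0"
    by blast
  define r where "r = csqrt (\<i> / \<omega> / qform \<beta>1 \<beta>2 v1 v2)"
  have r: "r * r * qform \<beta>1 \<beta>2 v1 v2 = \<i> / \<omega>"
    using q by (simp add: r_def flip: power2_eq_square)
  have u': "r * v1 + \<alpha>1 * (r * v2) = - \<kappa> * (r * v1)"
  proof -
    have "r * v1 + \<alpha>1 * (r * v2) = r * (v1 + \<alpha>1 * v2)" by (simp add: algebra_simps)
    then show ?thesis unfolding u by (simp add: algebra_simps)
  qed
  have v': "r * v2 + \<alpha>2 * (r * v1) = \<kappa> * (r * v2)"
  proof -
    have "r * v2 + \<alpha>2 * (r * v1) = r * (v2 + \<alpha>2 * v1)" by (simp add: algebra_simps)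
    then show ?thesis unfolding v by (simp add: algebra_simps)
  qed
  \<comment> \<open>Here \<open>D = - \<kappa> * Q\<close>, so the nonlinear term is
    \<open>(x1, x2) / Q = - \<i> * \<omega> * (x1, x2)\<close> and cancels the linear one.\<close>
  have D: "denom \<alpha>1 \<alpha>2 \<beta>1 \<beta>2 (r * v1) (r * v2) = - \<kappa> * (\<i> / \<omega>)"
    unfolding denom_eq u' v' r[symmetric]
    by (simp add: qform_def power2_eq_square algebra_simps)
  have "nonsingular_solution \<omega> \<alpha>1 \<alpha>2 \<beta>1 \<beta>2 (\<lambda>t. r * v1) (\<lambda>t. r * v2)"
    unfolding nonsingular_solution_def D u' v'
    using \<kappa> \<omega> by (auto simp: field_simps)
  then show ?thesis by blast
qed

text \<open>For \<open>\<alpha>\<^sub>1 \<alpha>\<^sub>2 = 1\<close> the form \<open>H\<close> is a multiple of the square of \<open>x\<^sub>1 + \<alpha>\<^sub>1 x\<^sub>2\<close>; take this linear form to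
  be \<open>E = exp (\<i>\<omega>t)\<close> and solve \<open>Q = \<i> / \<omega> + C E\<^sup>2\<close> for \<open>x\<^sub>2\<close>, choosing \<open>C\<close> so that the solution is a
  Laurent polynomial in \<open>E\<close>.\<close>

lemma degenerate_solution_exists:
  assumes \<omega>: "\<omega> \<noteq> 0" and \<alpha>: "\<alpha>1 * \<alpha>2 = 1" and \<beta>: "\<beta>1 \<noteq> 0 \<or> \<beta>2 \<noteq> 0"
  shows "\<exists>a b c. nonsingular_solution \<omega> \<alpha>1 \<alpha>2 \<beta>1 \<beta>2
     (\<lambda>t. exp (\<i> * \<omega> * of_real t) -
        \<alpha>1 * (a * exp (\<i> * \<omega> * of_real t) + b + c * exp (- (\<i> * \<omega>) * of_real t)))
     (\<lambda>t. a * exp (\<i> * \<omega> * of_real t) + b + c * exp (- (\<i> * \<omega>) * of_real t))"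
proof -
  define E F where "E = (\<lambda>t. exp (\<i> * \<omega> * of_real t))"
    and "F = (\<lambda>t. exp (- (\<i> * \<omega>) * of_real t))"
  have EF: "F t = 1 / E t" and E0: "E t \<noteq> 0" for t
    by (simp_all add: E_def F_def exp_minus field_simps)
  have dE: "(E has_vector_derivative \<i> * \<omega> * E t) (at t)"
    and dF: "(F has_vector_derivative - (\<i> * \<omega>) * F t) (at t)" for t
    unfolding E_def F_def by (rule exp_linear_has_vector_derivative)+
  define g where "g = \<beta>1 * \<alpha>1 - \<beta>2 * \<alpha>2"
  \<comment> \<open>Since \<open>\<alpha>1 * \<alpha>2 = 1\<close>, taking \<open>u = E\<close>
    gives \<open>v = \<alpha>2 * E\<close> and \<open>D = E * G\<close>. The system reduces to
    \<open>y' = \<i> * \<omega> * y - \<alpha>2 / G\<close> for \<open>y = x2\<close>, which is the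
    condition \<open>ode\<close>.\<close>
  have crit: "nonsingular_solution \<omega> \<alpha>1 \<alpha>2 \<beta>1 \<beta>2 (\<lambda>t. E t - \<alpha>1 * (a * E t + b + c * F t))
      (\<lambda>t. a * E t + b + c * F t)"
    if G0: "\<And>t. G t \<noteq> 0"
      and G: "\<And>t. \<beta>1 * E t - g * (a * E t + b + c * F t) = G t"
      and ode: "\<And>t. \<i> * \<omega> * (b + 2 * c * F t) = \<alpha>2 / G t" for a b c G
  proof -
    let ?y = "\<lambda>t. a * E t + b + c * F t"
    have u: "E t - \<alpha>1 * ?y t + \<alpha>1 * ?y t = E t" for t by simp
    have v: "?y t + \<alpha>2 * (E t - \<alpha>1 * ?y t) = \<alpha>2 * E t" for t
    proof -
      have "?y t + \<alpha>2 * (E t - \<alpha>1 * ?y t) = \<alpha>2 * E t + (1 - \<alpha>1 * \<alpha>2) * ?y t"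
        by (simp add: algebra_simps)
      then show ?thesis by (simp add: \<alpha>)
    qed
    have D: "denom \<alpha>1 \<alpha>2 \<beta>1 \<beta>2 (E t - \<alpha>1 * ?y t) (?y t) = E t * G t" for t
      unfolding denom_eq u v G[symmetric] g_def by (simp only: algebra_simps)
    have dy: "(?y has_vector_derivative a * (\<i> * \<omega> * E t) + 0 + c * (- (\<i> * \<omega>) * F t)) (at t)" for t
      by (intro has_vector_derivative_add has_vector_derivative_mult_right
          has_vector_derivative_const dE dF)
    have y': "a * (\<i> * \<omega> * E t) + 0 + c * (- (\<i> * \<omega>) * F t)
        = \<i> * \<omega> * ?y t - \<alpha>2 * E t / (E t * G t)" for t
      using ode[of t] E0[of t] by (simp add: algebra_simps)
    have dx: "((\<lambda>t. E t - \<alpha>1 * ?y t) has_vector_derivative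
        \<i> * \<omega> * E t - \<alpha>1 * (\<i> * \<omega> * ?y t - \<alpha>2 * E t / (E t * G t))) (at t)" for t
      by (intro has_vector_derivative_diff has_vector_derivative_mult_right dE dy[unfolded y'])
    have x': "\<i> * \<omega> * E t - \<alpha>1 * (\<i> * \<omega> * ?y t - \<alpha>2 * E t / (E t * G t))
        = \<i> * \<omega> * (E t - \<alpha>1 * ?y t) + E t / (E t * G t)" for t
    proof -
      have "\<i> * \<omega> * E t - \<alpha>1 * (\<i> * \<omega> * ?y t - \<alpha>2 * E t / (E t * G t))
        = \<i> * \<omega> * (E t - \<alpha>1 * ?y t) + (\<alpha>1 * \<alpha>2) * (E t / (E t * G t))"
        by (simp add: algebra_simps)
      then show ?thesis by (simp add: \<alpha>)
    qed
    show ?thesis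
      unfolding nonsingular_solution_def u v D
      using dy[unfolded y'] dx[unfolded x'] E0 G0 by simp
  qed
  have \<alpha>0: "\<alpha>1 \<noteq> 0" "\<alpha>2 \<noteq> 0" using \<alpha> by auto
  show ?thesis
  proof (cases "g = 0")
    case False
    \<comment> \<open>With \<open>a = \<beta>1 / g\<close> and \<open>c = 0\<close>,
      \<open>G\<close> is the constant \<open>- g * b\<close>, and \<open>ode\<close> becomes this
      quadratic equation for \<open>b\<close>.\<close>
    define b where "b = csqrt (\<alpha>2 * \<i> / (g * \<omega>))"
    have bb: "b * b = \<alpha>2 * \<i> / (g * \<omega>)"
      by (simp add: b_def flip: power2_eq_square)
    then have b0: "b \<noteq> 0" using \<alpha>0 \<omega> False by auto
    have "nonsingular_solution \<omega> \<alpha>1 \<alpha>2 \<beta>1 \<beta>2 (\<lambda>t. E t - \<alpha>1 * (\<beta>1 / g * E t + b + 0 * F t))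
        (\<lambda>t. \<beta>1 / g * E t + b + 0 * F t)"
    proof (rule crit[of "\<lambda>t. - g * b"])
      show "\<i> * \<omega> * (b + 2 * 0 * F t) = \<alpha>2 / (- g * b)" for t
      proof -
        have "\<i> * \<omega> * b * (- g * b) = - \<i> * \<omega> * g * (b * b)" by (simp add: algebra_simps)
        also have "\<dots> = \<alpha>2" unfolding bb using False \<omega> by (simp add: field_simps)
        finally show ?thesis
          by (subst eq_divide_eq) (use b0 False in auto)
      qed
    qed (use b0 False in \<open>auto simp: field_simps\<close>)
    then show ?thesis unfolding E_def F_def by blast
  next
    case True
    have \<beta>1: "\<beta>1 \<noteq> 0"
      using True \<beta> \<alpha>0 by (auto simp: g_def)
    \<comment> \<open>Now \<open>G = \<beta>1 * E\<close>, so with \<open>a = b = 0\<close> both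
      sides of \<open>ode\<close> are multiples of \<open>F\<close>; comparing coefficients gives
      \<open>c\<close>.\<close>
    define c where "c = \<alpha>2 / (2 * \<i> * \<omega> * \<beta>1)"
    have "nonsingular_solution \<omega> \<alpha>1 \<alpha>2 \<beta>1 \<beta>2 (\<lambda>t. E t - \<alpha>1 * (0 * E t + 0 + c * F t))
        (\<lambda>t. 0 * E t + 0 + c * F t)"
      by (rule crit[of "\<lambda>t. \<beta>1 * E t"])
        (use \<beta>1 E0 True \<omega> in \<open>auto simp: c_def EF field_simps\<close>)
    then show ?thesis unfolding E_def F_def by blast
  qed
qed

theorem mainTheorem2:
  fixes \<omega> :: real and \<alpha>1 \<alpha>2 \<beta>1 \<beta>2 :: complex
  assumes "\<omega> \<noteq> 0"
  shows "isochronous_with_period \<omega> \<alpha>1 \<alpha>2 \<beta>1 \<beta>2 (4 * basic_period \<omega>) \<and>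
         (\<beta>1 \<noteq> 0 \<or> \<beta>2 \<noteq> 0 \<longrightarrow>
            (\<exists>x1 x2. nonsingular_solution \<omega> \<alpha>1 \<alpha>2 \<beta>1 \<beta>2 x1 x2 \<and>
                     completely_periodic (2 * basic_period \<omega>) x1 x2))"
proof (intro conjI impI)
  show "isochronous_with_period \<omega> \<alpha>1 \<alpha>2 \<beta>1 \<beta>2 (4 * basic_period \<omega>)"
    using nonsingular_solution_period assms by (simp add: isochronous_with_period_def)
next
  assume \<beta>: "\<beta>1 \<noteq> 0 \<or> \<beta>2 \<noteq> 0"
  show "\<exists>x1 x2. nonsingular_solution \<omega> \<alpha>1 \<alpha>2 \<beta>1 \<beta>2 x1 x2 \<and>
                completely_periodic (2 * basic_period \<omega>) x1 x2"
  \<comment> \<open>An equilibrium has every period; the degenerate solution is a Laurent polynomial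
    in \<open>exp (\<i> * \<omega> * of_real t)\<close>.\<close>
  proof (cases "\<alpha>1 * \<alpha>2 = 1")
    case False
    then show ?thesis
      using equilibrium_exists[OF assms False \<beta>] by (fastforce simp: completely_periodic_def)
  next
    case True
    note E = exp_twice_basic_period[OF assms]
    have F: "exp (- (\<i> * \<omega>) * of_real (t + 2 * basic_period \<omega>)) = exp (- (\<i> * \<omega>) * of_real t)" for t
      unfolding mult_minus_left exp_minus E ..
    show ?thesis
      using degenerate_solution_exists[OF assms True \<beta>]
      unfolding completely_periodic_def
      by (elim exE, intro exI conjI allI) (assumption, (simp only: E F)+)
  qed
qed

end
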